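(* Let $(C,\phi)$ be a semicoherent system with $C=\{1,\ldots,n\}$ and with continuous and exchangeable component lifetimes $T_1,\ldots,T_n$, let $h$ be its reliability function, let $M\subseteq C$ be nonempty and let $m=|M|$. Let $h(x,z)$ be the bivariate polynomial obtained from $h(\mathbf{x})$ by replacing every variable $x_i$ with $i\in M$ by $x$ and every variable $x_i$ with $i\in C\setminus M$ by $z$, and let $g(x,z)=\partial_x h(x,z)$. Then $$\sum_{k=1}^m s_M^{(k)}\,x^k=\int_0^1 x\,R_t^{m-1}\big((R_1^{m-1}g)((t-1)x+1,\,z)\big)\big|_{z=t}\,dt,$$ where the reflection $R_t^{m-1}$ with respect to $t$ is applied first (with $x,z$ treated as parameters) and then $z$ is set equal to $t$. In particular, $$\sum_{k=1}^m s_M^{(k)}=\sum_{j\in M}I_{\mathrm{BP}}^{(j)}=\int_0^1 g(t,t)\,dt.$$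
   Context: System: $C=\{1,\ldots,n\}$ is the set of components and $\phi\colon\{0,1\}^n\to\{0,1\}$ is the structure function, giving the state of the system from the states of the components. Semicoherent means that $\phi$ is nondecreasing in each variable, $\phi(0,\ldots,0)=0$ and $\phi(1,\ldots,1)=1$. Boolean vectors $\mathbf{x}\in\{0,1\}^n$ are identified with subsets $A\subseteq C$ via $x_i=1$ iff $i\in A$, so $\phi(A)$ makes sense. Lifetimes: $T_1,\ldots,T_n$ are nonnegative random variables on a common probability space, exchangeable (their joint distribution is invariant under permutations of the indices) and continuous, in the sense that there are no ties almost surely: $\Pr(T_i=T_j)=0$ for $i\neq j$. The system lifetime is $T_S=\max_{A\subseteq C,\ \phi(A)=1}\ \min_{i\in A}T_i$ (the system works at time $t$ iff $\phi$ equals $1$ at the vector of component states at time $t$). $M$-signature: for nonempty $M\subseteq C$ with $m=|M|$, it is the $m$-tuple $\mathbf{s}_M=(s_M^{(1)},\ldots,s_M^{(m)})$ with $s_M^{(k)}=\Pr(T_S=T_{k:M})$, $k\in\{1,\ldots,m\}$, where $T_{k:M}$ is the $k$-th smallest of the variables $T_i$, $i\in M$. Barlow-Proschan index of component $j$: $I_{\mathrm{BP}}^{(j)}=\Pr(T_S=T_j)$. Reliability function: the multilinear polynomial $h(\mathbf{x})=h(x_1,\ldots,x_n)=\sum_{A\subseteq C}\phi(A)\prod_{i\in A}x_i\prod_{i\in C\setminus A}(1-x_i)$. Reflection: for a polynomial $f(x)=a_px^p+\cdots+a_1x+a_0$ of degree at most $p$, the $p$-reflected polynomial is $(R^pf)(x)=a_0x^p+a_1x^{p-1}+\cdots+a_p$,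 i.e. $(R^pf)(x)=x^pf(1/x)$. $R_1^{m-1}g$ is the $(m-1)$-reflected of $g$ with respect to its first argument ($g(x,z)$ has degree at most $m-1$ in $x$), and $R_t^{m-1}$ denotes the $(m-1)$-reflection with respect to the variable $t$. *)

theory Defs
  imports
    "HOL-Probability.Probability"
    "HOL-Computational_Algebra.Polynomial"
    "HOL-Combinatorics.Permutations"
begin

text \<open>
  A Boolean vector in \<open>{0,1}\<^sup>n\<close> is represented by the set \<open>A \<subseteq> {1..n}\<close> of its components
  with value 1, and a structure function by a predicate on such sets; its values on other
  sets are irrelevant.
\<close>

definition semicoherent :: "nat \<Rightarrow> (nat set \<Rightarrow> bool) \<Rightarrow> bool" where
  "semicoherent n \<phi> \<longleftrightarrow>
     (\<forall>i\<in>{1..n}. \<forall>A. A \<subseteq> {1..n} - {i} \<longrightarrow> \<phi> A \<le> \<phi> (insert i A)) \<and>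
     \<not> \<phi> {} \<and> \<phi> {1..n}"

definition exchangeable :: "'a measure \<Rightarrow> 'i set \<Rightarrow> ('i \<Rightarrow> 'a \<Rightarrow> real) \<Rightarrow> bool" where
  "exchangeable P I T \<longleftrightarrow>
     (\<forall>\<pi>. \<pi> permutes I \<longrightarrow>
        distr P (\<Pi>\<^sub>M i\<in>I. borel) (\<lambda>\<omega>. \<lambda>i\<in>I. T (\<pi> i) \<omega>) =
        distr P (\<Pi>\<^sub>M i\<in>I. borel) (\<lambda>\<omega>. \<lambda>i\<in>I. T i \<omega>))"

definition no_ties :: "'a measure \<Rightarrow> 'i set \<Rightarrow> ('i \<Rightarrow> 'a \<Rightarrow> real) \<Rightarrow> bool" where
  "no_ties P I T \<longleftrightarrow>
     (\<forall>i\<in>I. \<forall>j\<in>I. i \<noteq> j \<longrightarrow> measure P {\<omega> \<in> space P. T i \<omega> = T j \<omega>} = 0)"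

definition system_lifetime ::
    "nat \<Rightarrow> (nat set \<Rightarrow> bool) \<Rightarrow> (nat \<Rightarrow> 'a \<Rightarrow> real) \<Rightarrow> 'a \<Rightarrow> real" where
  "system_lifetime n \<phi> T \<omega> =
     Max ((\<lambda>A. Min ((\<lambda>i. T i \<omega>) ` A)) ` {A. A \<subseteq> {1..n} \<and> \<phi> A})"

text \<open>The \<open>k\<close>-th smallest of the \<open>T i\<close>, \<open>i \<in> M\<close>, for \<open>1 \<le> k \<le> card M\<close>.\<close>

definition order_statistic ::
    "nat \<Rightarrow> nat set \<Rightarrow> (nat \<Rightarrow> 'a \<Rightarrow> real) \<Rightarrow> 'a \<Rightarrow> real" where
  "order_statistic k M T \<omega> = sort (map (\<lambda>i. T i \<omega>) (sorted_list_of_set M)) ! (k - 1)"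

definition M_signature ::
    "nat \<Rightarrow> (nat set \<Rightarrow> bool) \<Rightarrow> 'a measure \<Rightarrow> (nat \<Rightarrow> 'a \<Rightarrow> real) \<Rightarrow> nat set \<Rightarrow> nat \<Rightarrow> real" where
  "M_signature n \<phi> P T M k =
     measure P {\<omega> \<in> space P. system_lifetime n \<phi> T \<omega> = order_statistic k M T \<omega>}"

definition barlow_proschan ::
    "nat \<Rightarrow> (nat set \<Rightarrow> bool) \<Rightarrow> 'a measure \<Rightarrow> (nat \<Rightarrow> 'a \<Rightarrow> real) \<Rightarrow> nat \<Rightarrow> real" where
  "barlow_proschan n \<phi> P T j = measure P {\<omega> \<in> space P. system_lifetime n \<phi> T \<omega> = T j \<omega>}"

text \<open>
  The arguments range over an arbitrary commutative ring, so that polynomials can be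
  substituted for the variables as well as numbers.
\<close>

definition reliability ::
    "nat \<Rightarrow> (nat set \<Rightarrow> bool) \<Rightarrow> (nat \<Rightarrow> 'r::comm_ring_1) \<Rightarrow> 'r" where
  "reliability n \<phi> x =
     (\<Sum>A\<in>Pow {1..n}. of_bool (\<phi> A) * (\<Prod>i\<in>A. x i) * (\<Prod>i\<in>{1..n} - A. 1 - x i))"

text \<open>
  A bivariate polynomial is a polynomial in its first variable whose coefficients are
  polynomials in the second one, so the two variables are \<open>[:0, 1:]\<close> and \<open>[:[:0, 1:]:]\<close>,
  and \<open>pderiv\<close> is the partial derivative with respect to the first one.
\<close>

definition bivariate_reliability ::
    "nat \<Rightarrow> (nat set \<Rightarrow> bool) \<Rightarrow> nat set \<Rightarrow> real poly poly" where
  "bivariate_reliability n \<phi> M =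
     reliability n \<phi> (\<lambda>i. if i \<in> M then [:0, 1:] else [:[:0, 1:]:])"

definition poly2 :: "real poly poly \<Rightarrow> real \<Rightarrow> real \<Rightarrow> real" where
  "poly2 f x z = poly (poly f [:x:]) z"

text \<open>
  Unlike \<open>reflect_poly\<close>, this reflects at a given bound \<open>p\<close> on the degree and not at the
  degree itself. On a bivariate polynomial it reflects with respect to the first variable.
\<close>

definition reflected :: "nat \<Rightarrow> 'r::comm_ring_1 poly \<Rightarrow> 'r poly" where
  "reflected p f = (\<Sum>i\<le>p. monom (coeff f i) (p - i))"

text \<open>
  The polynomial \<open>f ((t - 1) x + 1, z)\<close> in the first variable \<open>t\<close> and the second variable \<open>z\<close>,
  for a fixed number \<open>x\<close>.
\<close>

definition affine_subst :: "real \<Rightarrow> real poly poly \<Rightarrow> real poly poly" where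
  "affine_subst x f = pcompose f (([:0, 1:] - 1) * [:[:x:]:] + 1)"

end

theory Submission
  imports Defs
begin

text \<open>
  Both sides are sums over the \<^emph>\<open>critical pairs\<close> \<open>(j, A)\<close>: \<open>j\<close> is a component in \<open>M\<close> and \<open>A\<close> a
  set of other components such that the system works with \<open>insert j A\<close> but not with \<open>A\<close>.

  On the probabilistic side, let \<open>A\<close> be the set of components that outlive \<open>j\<close>. The system dies
  together with \<open>j\<close> iff \<open>(j, A)\<close> is critical, and then \<open>j\<close> is the component of rank
  \<open>m - card (A \<inter> M)\<close> in \<open>M\<close>. By exchangeability, \<open>A\<close> is exactly the set of components outliving
  \<open>j\<close> with a probability that depends on the size \<open>a\<close> of \<open>A\<close> alone, namely
  \<open>a! * (n - 1 - a)! / n!\<close> (lemma \<open>measure_strictly_above\<close>). Hence the generating function of the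
  signature is the sum of \<open>x ^ (m - card (A \<inter> M)) * a! * (n - 1 - a)! / n!\<close> over the critical
  pairs, and the sum of the Barlow-Proschan indices is the same sum at \<open>x = 1\<close>
  (\<open>signature_generating_function\<close>, \<open>sum_barlow_proschan\<close>).

  On the analytic side, \<open>g (x, z)\<close> is the sum over the critical pairs of
  \<open>x ^ p * (1 - x) ^ q * z ^ r * (1 - z) ^ s\<close>, where \<open>p\<close> and \<open>q\<close> count the components of
  \<open>M - {j}\<close> inside and outside \<open>A\<close>, and \<open>r\<close> and \<open>s\<close> do so for the components outside \<open>M\<close>
  (\<open>pderiv_bivariate_reliability\<close>). The two reflections and the substitution between them turn the
  first two factors into \<open>x ^ q * t ^ p * (1 - t) ^ q\<close> (\<open>reflect_subst_reflect_bernstein\<close>). At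
  \<open>z = t\<close> the powers of \<open>t\<close> and \<open>1 - t\<close> collect to \<open>t ^ a * (1 - t) ^ (n - 1 - a)\<close>, whose integral
  is \<open>a! * (n - 1 - a)! / n!\<close> again, and \<open>q + 1 = m - card (A \<inter> M)\<close>.
\<close>

section \<open>Beta integrals\<close>

text \<open>
  For \<open>a < n\<close>, this is the probability that, in a uniformly random ranking of \<open>n\<close> items, exactly
  \<open>a\<close> given items stand above another given one. It is also the integral of
  \<open>t ^ a * (1 - t) ^ (n - 1 - a)\<close> over \<open>[0, 1]\<close>, which is what links the two sides of the theorem.
\<close>
definition arrangement_prob :: "nat \<Rightarrow> nat \<Rightarrow> real" where
  "arrangement_prob n a = fact a * fact (n - 1 - a) / fact n"

lemma has_integral_bernstein:
  "((\<lambda>t. t ^ a * (1 - t) ^ b) has_integral (fact a * fact b / fact (a + b + 1))) {0..1::real}"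
proof -
  have "((\<lambda>t. t powr (real (Suc a) - 1) * (1 - t) powr (real (Suc b) - 1))
      has_integral Beta (real (Suc a)) (real (Suc b))) {0..1}"
    by (rule has_integral_Beta_real) auto
  moreover have "Beta (real (Suc a)) (real (Suc b)) = fact a * fact b / fact (a + b + 1)"
    using Gamma_fact[of a, where 'a = real] Gamma_fact[of b, where 'a = real]
      Gamma_fact[of "a + b + 1", where 'a = real]
    by (simp add: Beta_def add_ac)
  \<comment> \<open>At the endpoints \<open>0 powr 0\<close> and \<open>0 ^ 0\<close> differ, so the powers are exchanged on the open interval.\<close>
  ultimately have "((\<lambda>t. t powr (real (Suc a) - 1) * (1 - t) powr (real (Suc b) - 1))
      has_integral (fact a * fact b / fact (a + b + 1))) {0<..<1::real}"
    by (simp only: has_integral_Icc_iff_Ioo)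
  then have "((\<lambda>t. t ^ a * (1 - t) ^ b) has_integral (fact a * fact b / fact (a + b + 1))) {0<..<1::real}"
    by (rule has_integral_eq[rotated]) (simp add: powr_realpow)
  then show ?thesis
    by (simp only: has_integral_Icc_iff_Ioo)
qed

lemma integral_sum_bernstein:
  assumes "finite J" "\<And>p. p \<in> J \<Longrightarrow> a p < n"
  shows "integral {0..1} (\<lambda>t::real. \<Sum>p\<in>J. c p * (t ^ a p * (1 - t) ^ (n - 1 - a p))) =
    (\<Sum>p\<in>J. c p * arrangement_prob n (a p))"
proof (rule integral_unique, rule has_integral_sum[OF assms(1)], rule has_integral_mult_right)
  fix p assume "p \<in> J"
  then have "a p + (n - 1 - a p) + 1 = n" using assms(2)[of p] by simp
  then show "((\<lambda>t. t ^ a p * (1 - t) ^ (n - 1 - a p)) has_integral arrangement_prob n (a p)) {0..1}"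
    using has_integral_bernstein[of "a p" "n - 1 - a p"] by (simp only: arrangement_prob_def)
qed

section \<open>Thresholds for order statistics and system lifetimes\<close>

lemma nth_sorted_upward_closed_iff:
  assumes "sorted ys" "i < length ys" "\<And>x y. x \<le> y \<Longrightarrow> Q x \<Longrightarrow> Q y"
  shows "Q (ys ! i) \<longleftrightarrow> length ys - i \<le> length (filter Q ys)"
proof
  \<comment> \<open>In a sorted list the positions satisfying an upward closed property form a final segment.\<close>
  assume Q: "Q (ys ! i)"
  have "{i..<length ys} \<subseteq> {p. p < length ys \<and> Q (ys ! p)}"
    by (auto intro!: assms(3)[OF _ Q] sorted_nth_mono[OF assms(1)])
  then have "card {i..<length ys} \<le> card {p. p < length ys \<and> Q (ys ! p)}"
    by (intro card_mono) auto
  then show "length ys - i \<le> length (filter Q ys)"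
    by (simp add: length_filter_conv_card)
next
  assume le: "length ys - i \<le> length (filter Q ys)"
  show "Q (ys ! i)"
  proof (rule ccontr)
    assume nQ: "\<not> Q (ys ! i)"
    have "{p. p < length ys \<and> Q (ys ! p)} \<subseteq> {Suc i..<length ys}"
    proof
      fix p assume p: "p \<in> {p. p < length ys \<and> Q (ys ! p)}"
      have "\<not> p \<le> i"
        using p nQ assms(3) sorted_nth_mono[OF assms(1) _ assms(2), of p] by blast
      with p show "p \<in> {Suc i..<length ys}" by auto
    qed
    then have "card {p. p < length ys \<and> Q (ys ! p)} \<le> card {Suc i..<length ys}"
      by (intro card_mono) auto
    with le assms(2) show False by (simp add: length_filter_conv_card)
  qed
qed

text \<open>
  Taken for \<open>Q = (\<le>) t\<close> and \<open>Q = (<) t\<close>, this turns questions about an order statistic into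
  counting the components that survive a threshold.
\<close>
lemma order_statistic_upward_closed_iff:
  assumes "finite M" "k \<in> {1..card M}" "\<And>x y. x \<le> y \<Longrightarrow> Q x \<Longrightarrow> Q y"
  shows "Q (order_statistic k M T \<omega>) \<longleftrightarrow> card M - k < card {i\<in>M. Q (T i \<omega>)}"
proof -
  let ?f = "\<lambda>i. T i \<omega>" and ?xs = "sorted_list_of_set M"
  have "length (filter Q (sort (map ?f ?xs))) = card {i\<in>M. Q (T i \<omega>)}"
  proof -
    have "length (filter Q (sort (map ?f ?xs))) = length (filter Q (map ?f ?xs))"
      by (metis mset_filter mset_sort size_mset)
    also have "\<dots> = length (filter (\<lambda>i. Q (T i \<omega>)) ?xs)"
      by (simp add: filter_map o_def)
    also have "\<dots> = card (set (filter (\<lambda>i. Q (T i \<omega>)) ?xs))"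
      by (rule distinct_card[symmetric]) simp
    also have "set (filter (\<lambda>i. Q (T i \<omega>)) ?xs) = {i\<in>M. Q (T i \<omega>)}"
      using assms(1) by auto
    finally show ?thesis .
  qed
  moreover have "Q (sort (map ?f ?xs) ! (k - 1)) \<longleftrightarrow>
      length (sort (map ?f ?xs)) - (k - 1) \<le> length (filter Q (sort (map ?f ?xs)))"
  proof (rule nth_sorted_upward_closed_iff)
    show "k - 1 < length (sort (map ?f ?xs))" using assms(2) by simp linarith
  qed (rule sorted_sort, fact assms(3))
  moreover have "length (sort (map ?f ?xs)) - (k - 1) = Suc (card M - k)"
    using assms(2) by simp linarith
  ultimately show ?thesis by (simp only: order_statistic_def Suc_le_eq)
qed

lemma order_statistic_eq_iff:
  assumes "finite M" "k \<in> {1..card M}"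
  shows "order_statistic k M T \<omega> = t \<longleftrightarrow>
    card {i\<in>M. t < T i \<omega>} \<le> card M - k \<and> card M - k < card {i\<in>M. t \<le> T i \<omega>}"
proof -
  have "t \<le> order_statistic k M T \<omega> \<longleftrightarrow> card M - k < card {i\<in>M. t \<le> T i \<omega>}"
    by (rule order_statistic_upward_closed_iff[OF assms]) auto
  moreover have "t < order_statistic k M T \<omega> \<longleftrightarrow> card M - k < card {i\<in>M. t < T i \<omega>}"
    by (rule order_statistic_upward_closed_iff[OF assms]) auto
  ultimately show ?thesis by linarith
qed

lemma order_statistic_in:
  assumes "finite M" "k \<in> {1..card M}"
  shows "\<exists>j\<in>M. order_statistic k M T \<omega> = T j \<omega>"
proof -
  let ?ys = "sort (map (\<lambda>i. T i \<omega>) (sorted_list_of_set M))"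
  have "?ys ! (k - 1) \<in> set ?ys" using assms by (intro nth_mem) auto
  then show ?thesis using assms(1) by (auto simp: order_statistic_def)
qed

lemma semicoherent_mono:
  assumes "semicoherent n \<phi>" "A \<subseteq> B" "B \<subseteq> {1..n}" "\<phi> A"
  shows "\<phi> B"
proof -
  have "finite (B - A)" using assms by (meson finite_Diff finite_atLeastAtMost finite_subset)
  moreover have "A \<union> D \<subseteq> {1..n} \<longrightarrow> \<phi> (A \<union> D)" if "finite D" for D
    using that
  proof (induction D)
    case empty
    then show ?case using assms(4) by simp
  next
    case (insert i D)
    show ?case
    proof (cases "i \<in> A")
      case True
      then show ?thesis using insert by (simp add: insert_absorb)
    next
      case False
      have "\<phi> (A \<union> insert i D)" if sub: "A \<union> insert i D \<subseteq> {1..n}"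
      proof -
        have "\<phi> (A \<union> D)" using insert.IH sub by blast
        moreover have "i \<in> {1..n}" "A \<union> D \<subseteq> {1..n} - {i}"
          using False insert.hyps(2) sub by auto
        ultimately have "\<phi> (insert i (A \<union> D))"
          using assms(1) unfolding semicoherent_def by (metis le_boolE)
        then show ?thesis by simp
      qed
      then show ?thesis by blast
    qed
  qed
  moreover have "A \<union> (B - A) = B" using assms(2) by blast
  ultimately show ?thesis using assms(3) by metis
qed

text \<open>
  The max-min formula states that the system survives a threshold iff the set of surviving
  components is a working set: if some working set survives entirely, then by monotonicity the set
  of all survivors works too.
\<close>
lemma system_lifetime_upward_closed_iff:
  assumes "semicoherent n \<phi>" and "\<And>x y. x \<le> y \<Longrightarrow> Q x \<Longrightarrow> Q y"
  shows "Q (system_lifetime n \<phi> T \<omega>) \<longleftrightarrow> \<phi> {i\<in>{1..n}. Q (T i \<omega>)}"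
proof -
  let ?P = "{A. A \<subseteq> {1..n} \<and> \<phi> A}"
  let ?W = "{i\<in>{1..n}. Q (T i \<omega>)}"
  have Max_iff: "Q (Max Y) \<longleftrightarrow> (\<exists>y\<in>Y. Q y)" if "finite Y" "Y \<noteq> {}" for Y
    using that assms(2) by (meson Max_ge Max_in)
  have Min_iff: "Q (Min Y) \<longleftrightarrow> (\<forall>y\<in>Y. Q y)" if "finite Y" "Y \<noteq> {}" for Y
    using that assms(2) by (meson Min_le Min_in)
  have "?P \<noteq> {}" using assms(1) by (auto simp: semicoherent_def)
  then have "Q (system_lifetime n \<phi> T \<omega>) \<longleftrightarrow> (\<exists>A\<in>?P. Q (Min ((\<lambda>i. T i \<omega>) ` A)))"
    unfolding system_lifetime_def by (subst Max_iff) auto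
  also have "\<dots> \<longleftrightarrow> (\<exists>A\<in>?P. A \<subseteq> ?W)"
  proof (rule bex_cong[OF refl])
    fix A assume A: "A \<in> ?P"
    then have "finite A" "A \<noteq> {}"
      using assms(1) by (auto simp: semicoherent_def intro: finite_subset)
    then show "Q (Min ((\<lambda>i. T i \<omega>) ` A)) \<longleftrightarrow> A \<subseteq> ?W" using A by (subst Min_iff) auto
  qed
  also have "\<dots> \<longleftrightarrow> \<phi> ?W"
    using semicoherent_mono[OF assms(1), of _ ?W] by blast
  finally show ?thesis .
qed

lemma system_lifetime_eq_iff:
  assumes "semicoherent n \<phi>"
  shows "system_lifetime n \<phi> T \<omega> = t \<longleftrightarrow>
    \<phi> {i\<in>{1..n}. t \<le> T i \<omega>} \<and> \<not> \<phi> {i\<in>{1..n}. t < T i \<omega>}"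
proof -
  have "t \<le> system_lifetime n \<phi> T \<omega> \<longleftrightarrow> \<phi> {i\<in>{1..n}. t \<le> T i \<omega>}"
    by (rule system_lifetime_upward_closed_iff[OF assms]) auto
  moreover have "t < system_lifetime n \<phi> T \<omega> \<longleftrightarrow> \<phi> {i\<in>{1..n}. t < T i \<omega>}"
    by (rule system_lifetime_upward_closed_iff[OF assms]) auto
  ultimately show ?thesis by linarith
qed

section \<open>The relative order of exchangeable lifetimes\<close>

text \<open>
  The second condition excludes ties with \<open>j\<close>. It is there so that the events for different pairs
  \<open>(j, A)\<close>, be they critical or with \<open>A\<close> of a given size, exclude each other at every outcome and
  not only almost surely.
\<close>
definition strictly_above :: "'i set \<Rightarrow> ('i \<Rightarrow> real) \<Rightarrow> 'i \<Rightarrow> 'i set \<Rightarrow> bool" where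
  "strictly_above I y j A \<longleftrightarrow> {i\<in>I. y j < y i} = A \<and> {i\<in>I. y j \<le> y i} = insert j A"

lemma strictly_above_permuted:
  assumes "\<pi> permutes I"
  shows "strictly_above I y (\<pi> j) (\<pi> ` A) \<longleftrightarrow> strictly_above I (\<lambda>i. y (\<pi> i)) j A"
proof -
  have inj: "inj \<pi>" using assms by (rule permutes_inj)
  have image: "{i\<in>I. Q (y i)} = \<pi> ` {i\<in>I. Q (y (\<pi> i))}" for Q
  proof -
    have "{i\<in>\<pi> ` I. Q (y i)} = \<pi> ` {i\<in>I. Q (y (\<pi> i))}" by auto
    then show ?thesis using permutes_image[OF assms] by simp
  qed
  show ?thesis
    unfolding strictly_above_def image[of "\<lambda>x. y (\<pi> j) < x"] image[of "\<lambda>x. y (\<pi> j) \<le> x"]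
      image_insert[symmetric] inj_image_eq_iff[OF inj] ..
qed

lemma strictly_above_if_inj_on:
  assumes "inj_on y I" "j \<in> I"
  shows "strictly_above I y j {i\<in>I. y j < y i}"
  using assms by (force simp: strictly_above_def inj_on_def)

lemma strictly_above_unique:
  assumes "finite I" "j \<in> I" "j' \<in> I" "strictly_above I y j A" "strictly_above I y j' A'"
    and "card A = card A'"
  shows "j = j' \<and> A = A'"
proof -
  have *: "\<not> y k < y k'" if "k \<in> I" "k' \<in> I" "strictly_above I y k B" "strictly_above I y k' B'"
     "card B = card B'" for k k' B B'
  proof
    assume "y k < y k'"
    then have "B' \<subseteq> B" "k' \<in> B" "k' \<notin> B'"
      using that(2-4) by (auto simp: strictly_above_def)
    then have "B' \<subset> B" by blast
    moreover have "finite B" using that assms(1) unfolding strictly_above_def by auto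
    ultimately show False using that(5) psubset_card_mono by (metis less_irrefl)
  qed
  have "y j = y j'" using *[of j j' A A'] *[of j' j A' A] assms by linarith
  then show ?thesis using assms unfolding strictly_above_def by auto
qed

lemma ex_strictly_above_of_card:
  assumes "finite I" "inj_on y I" "a < card I"
  obtains j A where "j \<in> I" "A \<subseteq> I - {j}" "card A = a" "strictly_above I y j A"
proof -
  let ?r = "\<lambda>j. card {i\<in>I. y j < y i}"
  \<comment> \<open>The rank \<open>?r\<close> is injective, hence takes every value below \<open>card I\<close>.\<close>
  have "?r j \<noteq> ?r j'" if "j \<in> I" "j' \<in> I" "y j < y j'" for j j'
  proof -
    have "{i\<in>I. y j' < y i} \<subset> {i\<in>I. y j < y i}" using that by force
    then have "?r j' < ?r j" using assms(1) by (intro psubset_card_mono) auto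
    then show ?thesis by simp
  qed
  then have "y j = y j'" if "?r j = ?r j'" "j \<in> I" "j' \<in> I" for j j'
    using that by (cases "y j" "y j'" rule: linorder_cases) force+
  then have "inj_on ?r I"
    using assms(2) by (auto simp: inj_on_def)
  moreover have "?r ` I \<subseteq> {..<card I}"
  proof -
    have "?r j < card I" if "j \<in> I" for j
      using assms(1) that by (intro psubset_card_mono) auto
    then show ?thesis by auto
  qed
  ultimately have "?r ` I = {..<card I}"
    by (intro card_subset_eq) (simp_all add: card_image)
  then have "a \<in> ?r ` I" using assms(3) by simp
  then obtain j where j: "j \<in> I" "?r j = a" by auto
  show thesis
    by (rule that[OF j(1) _ j(2) strictly_above_if_inj_on[OF assms(2) j(1)]]) auto
qed

text \<open>
  Only finitely many pairs of sets can arise from the comparisons, so every event described by them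
  is measurable. This covers the events in the definitions of both signatures, for which
  measurability up to a null set would not suffice.
\<close>
lemma sets_comparison:
  fixes T :: "'i \<Rightarrow> 'a \<Rightarrow> real"
  assumes "finite I" "j \<in> I" "\<And>i. i \<in> I \<Longrightarrow> T i \<in> borel_measurable P"
  shows "{\<omega>\<in>space P. R {i\<in>I. T j \<omega> < T i \<omega>} {i\<in>I. T j \<omega> \<le> T i \<omega>}} \<in> sets P"
proof -
  have [measurable]: "T j \<in> borel_measurable P" using assms by blast
  let ?E = "\<lambda>(B, D). {\<omega>\<in>space P. \<forall>i\<in>I. (T j \<omega> < T i \<omega> \<longleftrightarrow> i \<in> B) \<and> (T j \<omega> \<le> T i \<omega> \<longleftrightarrow> i \<in> D)}"
  let ?K = "{p\<in>Pow I \<times> Pow I. R (fst p) (snd p)}"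
  have "?E (B, D) \<in> sets P" for B D
    unfolding prod.case
  proof (rule sets.sets_Collect_finite_All'[OF _ assms(1)])
    fix i assume "i \<in> I"
    then have [measurable]: "T i \<in> borel_measurable P" by (rule assms(3))
    show "{\<omega>\<in>space P. (T j \<omega> < T i \<omega> \<longleftrightarrow> i \<in> B) \<and> (T j \<omega> \<le> T i \<omega> \<longleftrightarrow> i \<in> D)} \<in> sets P"
      by measurable
  qed (use assms(2) in auto)
  then have "(\<Union>p\<in>?K. ?E p) \<in> sets P"
    using assms(1) by (intro sets.finite_UN) auto
  also have "(\<Union>p\<in>?K. ?E p) = {\<omega>\<in>space P. R {i\<in>I. T j \<omega> < T i \<omega>} {i\<in>I. T j \<omega> \<le> T i \<omega>}}"
    (is "_ = ?R")
  proof (intro equalityI subsetI)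
    fix \<omega> assume "\<omega> \<in> (\<Union>p\<in>?K. ?E p)"
    then obtain B D where BD: "B \<subseteq> I" "D \<subseteq> I" "R B D" "\<omega> \<in> space P"
      "\<forall>i\<in>I. (T j \<omega> < T i \<omega> \<longleftrightarrow> i \<in> B) \<and> (T j \<omega> \<le> T i \<omega> \<longleftrightarrow> i \<in> D)" by auto
    then have "{i\<in>I. T j \<omega> < T i \<omega>} = B" "{i\<in>I. T j \<omega> \<le> T i \<omega>} = D" by auto
    then show "\<omega> \<in> ?R" using BD by simp
  next
    fix \<omega> assume "\<omega> \<in> ?R"
    then show "\<omega> \<in> (\<Union>p\<in>?K. ?E p)"
      by (intro UN_I[of "({i\<in>I. T j \<omega> < T i \<omega>}, {i\<in>I. T j \<omega> \<le> T i \<omega>})"]) auto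
  qed
  finally show ?thesis .
qed

lemma sets_strictly_above:
  fixes T :: "'i \<Rightarrow> 'a \<Rightarrow> real"
  assumes "finite I" "j \<in> I" "\<And>i. i \<in> I \<Longrightarrow> T i \<in> borel_measurable P"
  shows "{\<omega>\<in>space P. strictly_above I (\<lambda>i. T i \<omega>) j A} \<in> sets P"
  unfolding strictly_above_def by (rule sets_comparison[OF assms])

text \<open>
  The pattern of comparisons is a measurable property of the joint vector of lifetimes, whose
  distribution is unchanged by \<open>\<pi>\<close>.
\<close>
lemma measure_strictly_above_permuted:
  assumes "finite I" "j \<in> I" "\<And>i. i \<in> I \<Longrightarrow> T i \<in> borel_measurable P"
    and "exchangeable P I T" "\<pi> permutes I"
  shows "measure P {\<omega>\<in>space P. strictly_above I (\<lambda>i. T i \<omega>) (\<pi> j) (\<pi> ` A)} =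
    measure P {\<omega>\<in>space P. strictly_above I (\<lambda>i. T i \<omega>) j A}"
proof -
  let ?N = "\<Pi>\<^sub>M i\<in>I. (borel :: real measure)"
  let ?S = "{y\<in>space ?N. strictly_above I y j A}"
  have S: "?S \<in> sets ?N"
    by (rule sets_strictly_above[OF assms(1,2), of "\<lambda>i y. y i"]) simp
  have eq: "measure P {\<omega>\<in>space P. strictly_above I (\<lambda>i. T (\<rho> i) \<omega>) j A} =
      measure (distr P ?N (\<lambda>\<omega>. \<lambda>i\<in>I. T (\<rho> i) \<omega>)) ?S" if "\<rho> permutes I" for \<rho>
  proof -
    have meas: "(\<lambda>\<omega>. \<lambda>i\<in>I. T (\<rho> i) \<omega>) \<in> measurable P ?N"
      using assms(3) permutes_in_image[OF that] by (intro measurable_restrict) simp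
    have cong: "strictly_above I (\<lambda>i\<in>I. T (\<rho> i) \<omega>) j A \<longleftrightarrow>
        strictly_above I (\<lambda>i. T (\<rho> i) \<omega>) j A" for \<omega>
      unfolding strictly_above_def using assms(2) by (simp cong: conj_cong)
    have "(\<lambda>\<omega>. \<lambda>i\<in>I. T (\<rho> i) \<omega>) -` ?S \<inter> space P =
        {\<omega>\<in>space P. strictly_above I (\<lambda>i. T (\<rho> i) \<omega>) j A}"
      using measurable_space[OF meas] cong by auto
    then show ?thesis by (simp add: measure_distr[OF meas S])
  qed
  have "distr P ?N (\<lambda>\<omega>. \<lambda>i\<in>I. T (\<pi> i) \<omega>) = distr P ?N (\<lambda>\<omega>. \<lambda>i\<in>I. T i \<omega>)"
    using assms(4,5) by (simp add: exchangeable_def)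
  then show ?thesis
    using eq[OF assms(5)] eq[OF permutes_id]
    by (simp add: strictly_above_permuted[OF assms(5)])
qed

text \<open>
  The symmetric group acts transitively on pairs of a point and a set of given size avoiding it,
  so by exchangeability all such pairs are equally likely to describe the ranking.
\<close>
lemma ex_permutation_of_pointed_subset:
  assumes "finite I" "j \<in> I" "j' \<in> I" "A \<subseteq> I - {j}" "A' \<subseteq> I - {j'}" "card A = card A'"
  obtains \<pi> where "\<pi> permutes I" "\<pi> j = j'" "\<pi> ` A = A'"
proof -
  have fin: "finite A" "finite A'" using assms by (meson finite_Diff finite_subset)+
  obtain f where f: "bij_betw f A A'"
    using fin assms(6) finite_same_card_bij by blast
  have "card (I - {j} - A) = card (I - {j'} - A')"
    using assms fin by (simp add: card_Diff_subset)
  then obtain g where g: "bij_betw g (I - {j} - A) (I - {j'} - A')"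
    using assms(1) finite_same_card_bij by (metis finite_Diff)
  define \<pi> where "\<pi> i = (if i = j then j' else if i \<in> A then f i else if i \<in> I then g i else i)" for i
  have A: "bij_betw \<pi> A A'"
    using f by (rule bij_betw_cong[THEN iffD1, rotated]) (use assms(4) in \<open>auto simp: \<pi>_def\<close>)
  moreover have "bij_betw \<pi> (I - {j} - A) (I - {j'} - A')"
    using g by (rule bij_betw_cong[THEN iffD1, rotated]) (auto simp: \<pi>_def)
  ultimately have "bij_betw \<pi> (A \<union> (I - {j} - A)) (A' \<union> (I - {j'} - A'))"
    by (rule bij_betw_combine) auto
  then have "bij_betw \<pi> ({j} \<union> (A \<union> (I - {j} - A))) ({j'} \<union> (A' \<union> (I - {j'} - A')))"
    by (rule bij_betw_combine[rotated]) (use assms(5) in \<open>auto simp: \<pi>_def\<close>)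
  moreover have "{j} \<union> (A \<union> (I - {j} - A)) = I" "{j'} \<union> (A' \<union> (I - {j'} - A')) = I"
    using assms by auto
  ultimately have "bij_betw \<pi> I I" by simp
  then have "\<pi> permutes I"
    by (rule bij_imp_permutes) (use assms in \<open>auto simp: \<pi>_def\<close>)
  moreover have "\<pi> j = j'" by (simp add: \<pi>_def)
  moreover have "\<pi> ` A = A'" using A by (rule bij_betw_imp_surj_on)
  ultimately show thesis by (rule that)
qed

lemma AE_inj_on_if_no_ties:
  assumes "prob_space P" "finite I" "\<And>i. i \<in> I \<Longrightarrow> T i \<in> borel_measurable P" "no_ties P I T"
  shows "AE \<omega> in P. inj_on (\<lambda>i. T i \<omega>) I"
proof -
  interpret prob_space P by fact
  have "AE \<omega> in P. i \<noteq> j \<longrightarrow> T i \<omega> \<noteq> T j \<omega>" if "i \<in> I" "j \<in> I" for i j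
  proof (cases "i = j")
    case False
    have [measurable]: "T i \<in> borel_measurable P" "T j \<in> borel_measurable P" using assms that by auto
    have "{\<omega>\<in>space P. T i \<omega> = T j \<omega>} \<in> null_sets P"
      using assms(4) that False by (intro null_setsI) (auto simp: no_ties_def emeasure_eq_measure)
    then show ?thesis by (rule AE_I') auto
  qed simp
  then have "AE \<omega> in P. \<forall>i\<in>I. \<forall>j\<in>I. i \<noteq> j \<longrightarrow> T i \<omega> \<noteq> T j \<omega>"
    using assms(2) by (simp add: AE_finite_all)
  then show ?thesis by eventually_elim (auto simp: inj_on_def)
qed

lemma measure_eq_sum_AE:
  assumes "prob_space P" "finite J" "{\<omega>\<in>space P. Q \<omega>} \<in> sets P"
    and "\<And>p. p \<in> J \<Longrightarrow> {\<omega>\<in>space P. E p \<omega>} \<in> sets P"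
    and "AE \<omega> in P. Q \<omega> \<longleftrightarrow> (\<exists>p\<in>J. E p \<omega>)"
    and "\<And>p q \<omega>. p \<in> J \<Longrightarrow> q \<in> J \<Longrightarrow> E p \<omega> \<Longrightarrow> E q \<omega> \<Longrightarrow> p = q"
  shows "measure P {\<omega>\<in>space P. Q \<omega>} = (\<Sum>p\<in>J. measure P {\<omega>\<in>space P. E p \<omega>})"
proof -
  interpret prob_space P by fact
  have "measure P {\<omega>\<in>space P. Q \<omega>} = measure P (\<Union>p\<in>J. {\<omega>\<in>space P. E p \<omega>})"
    using assms(2-5) by (intro finite_measure_eq_AE) auto
  also have "\<dots> = (\<Sum>p\<in>J. measure P {\<omega>\<in>space P. E p \<omega>})"
    using assms(2,4,6)
    by (intro finite_measure_finite_Union) (auto simp: disjoint_family_on_def)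
  finally show ?thesis .
qed

text \<open>
  The events for all pairs \<open>(j, A)\<close> with \<open>A\<close> of a given size \<open>a\<close> are equally likely by
  exchangeability and partition the probability space up to a null set, and there are
  \<open>n * (n - 1 choose a)\<close> of them.
\<close>
lemma measure_strictly_above:
  assumes "prob_space P" "finite I" "\<And>i. i \<in> I \<Longrightarrow> T i \<in> borel_measurable P"
    and "exchangeable P I T" "no_ties P I T" and "j \<in> I" "A \<subseteq> I - {j}"
  shows "measure P {\<omega>\<in>space P. strictly_above I (\<lambda>i. T i \<omega>) j A} =
    arrangement_prob (card I) (card A)"
proof -
  interpret prob_space P by fact
  let ?n = "card I" and ?a = "card A"
  let ?E = "\<lambda>(j, A) \<omega>. strictly_above I (\<lambda>i. T i \<omega>) j A"
  let ?J = "Sigma I (\<lambda>j. {A. A \<subseteq> I - {j} \<and> card A = ?a})"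
  let ?p = "measure P {\<omega>\<in>space P. ?E (j, A) \<omega>}"
  have noties: "AE \<omega> in P. inj_on (\<lambda>i. T i \<omega>) I"
    by (rule AE_inj_on_if_no_ties) (fact assms)+
  have n: "?n > 0" using assms by (auto simp: card_gt_0_iff)
  have "card A \<le> card (I - {j})" using assms by (intro card_mono) auto
  then have a: "?a \<le> ?n - 1" using assms by simp
  have finJ: "finite ?J"
    using assms(2) by (intro finite_SigmaI) (auto intro: finite_subset[of _ "Pow I"])
  \<comment> \<open>Almost surely exactly one component has exactly \<open>?a\<close> components above it, so the events
    indexed by \<open>?J\<close> have total probability 1.\<close>
  have "1 = measure P {\<omega>\<in>space P. True}" by (simp add: prob_space)
  also have "\<dots> = (\<Sum>q\<in>?J. measure P {\<omega>\<in>space P. ?E q \<omega>})"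
  proof (rule measure_eq_sum_AE)
    show "AE \<omega> in P. True \<longleftrightarrow> (\<exists>q\<in>?J. ?E q \<omega>)"
      using noties
    proof eventually_elim
      case (elim \<omega>)
      have "?a < ?n" using a n by simp
      then obtain j A' where "j \<in> I" "A' \<subseteq> I - {j}" "card A' = ?a"
          "strictly_above I (\<lambda>i. T i \<omega>) j A'"
        by (rule ex_strictly_above_of_card[OF assms(2) elim])
      then have "(j, A') \<in> ?J" "?E (j, A') \<omega>" by auto
      then show ?case by blast
    qed
    show "q = r" if qr: "q \<in> ?J" "r \<in> ?J" "?E q \<omega>" "?E r \<omega>" for q r \<omega>
    proof -
      obtain j1 A1 j2 A2 where [simp]: "q = (j1, A1)" "r = (j2, A2)" by fastforce
      have "j1 = j2 \<and> A1 = A2"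
        by (rule strictly_above_unique[OF assms(2), of _ _ "\<lambda>i. T i \<omega>"]) (use qr in auto)
      then show ?thesis by simp
    qed
    show "{\<omega>\<in>space P. ?E q \<omega>} \<in> sets P" if "q \<in> ?J" for q
    proof -
      obtain j1 A1 where q: "q = (j1, A1)" by fastforce
      have "{\<omega>\<in>space P. strictly_above I (\<lambda>i. T i \<omega>) j1 A1} \<in> sets P"
        by (rule sets_strictly_above[OF assms(2)]) (use that q assms(3) in auto)
      then show ?thesis by (simp add: q)
    qed
    show "prob_space P" by fact
    show "finite ?J" by (rule finJ)
    show "{\<omega>\<in>space P. True} \<in> sets P" by simp
  qed
  \<comment> \<open>Any two elements of \<open>?J\<close> are related by a permutation of the components, so all these
    events have the same probability.\<close>
  also have "\<dots> = (\<Sum>q\<in>?J. ?p)"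
  proof (rule sum.cong[OF refl])
    fix q assume "q \<in> ?J"
    then obtain j' A' where *: "q = (j', A')" "j' \<in> I" "A' \<subseteq> I - {j'}" "card A = card A'" by auto
    obtain \<pi> where \<pi>: "\<pi> permutes I" "\<pi> j = j'" "\<pi> ` A = A'"
      by (rule ex_permutation_of_pointed_subset[OF assms(2,6) *(2) assms(7) *(3,4)])
    show "measure P {\<omega>\<in>space P. ?E q \<omega>} = ?p"
      using measure_strictly_above_permuted[OF assms(2,6,3,4) \<pi>(1), of A] \<pi>(2,3) *(1)
      by simp
  qed
  also have "\<dots> = card ?J * ?p" by simp
  also have "card ?J = (\<Sum>j\<in>I. (?n - 1) choose ?a)"
    using assms(2) by (subst card_SigmaI) (auto simp: n_subsets card_Diff_singleton intro: finite_subset[of _ "Pow I"])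
  also have "real (\<Sum>j\<in>I. (?n - 1) choose ?a) = real ?n * (fact (?n - 1) / (fact ?a * fact (?n - 1 - ?a)))"
    using binomial_fact[OF a, where 'a = real] by simp
  also have "\<dots> = fact ?n / (fact ?a * fact (?n - 1 - ?a))"
    using fact_reduce[OF n, where 'a = real] by simp
  finally show ?thesis by (simp add: arrangement_prob_def field_simps)
qed

section \<open>Signatures as sums over critical sets\<close>

text \<open>
  The sets of other components for which the state of \<open>j\<close> decides the state of the system.
\<close>
definition critical_sets :: "nat \<Rightarrow> (nat set \<Rightarrow> bool) \<Rightarrow> nat \<Rightarrow> nat set set" where
  "critical_sets n \<phi> j = {A. A \<subseteq> {1..n} - {j} \<and> \<phi> (insert j A) \<and> \<not> \<phi> A}"

lemma finite_critical_sets: "finite (critical_sets n \<phi> j)"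
  by (rule finite_subset[of _ "Pow {1..n}"]) (auto simp: critical_sets_def)

text \<open>
  If \<open>A\<close> is the set of components outliving \<open>j\<close>, then the system dies together with \<open>j\<close> iff it still
  works with \<open>A\<close> and \<open>j\<close> but no longer with \<open>A\<close> alone.
\<close>
lemma system_lifetime_eq_component_iff:
  assumes "semicoherent n \<phi>" "strictly_above {1..n} (\<lambda>i. T i \<omega>) j A"
  shows "system_lifetime n \<phi> T \<omega> = T j \<omega> \<longleftrightarrow> \<phi> (insert j A) \<and> \<not> \<phi> A"
  using assms unfolding system_lifetime_eq_iff[OF assms(1)] strictly_above_def by simp

text \<open>
  Critical pairs exclude each other, because each of them names the component that dies with the
  system. Hence an event that amounts, ties apart, to the occurrence of one of several critical
  pairs has the sum of their probabilities. Both signatures are instances.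
\<close>
lemma measure_eq_sum_critical:
  fixes T :: "nat \<Rightarrow> 'a \<Rightarrow> real"
  assumes "prob_space P" "semicoherent n \<phi>" "\<And>i. i \<in> {1..n} \<Longrightarrow> T i \<in> borel_measurable P"
    and "exchangeable P {1..n} T" "no_ties P {1..n} T"
    and "J \<subseteq> Sigma {1..n} (critical_sets n \<phi>)" "{\<omega>\<in>space P. Q \<omega>} \<in> sets P"
    and "\<And>\<omega>. inj_on (\<lambda>i. T i \<omega>) {1..n} \<Longrightarrow>
      Q \<omega> \<longleftrightarrow> (\<exists>(j, A)\<in>J. strictly_above {1..n} (\<lambda>i. T i \<omega>) j A)"
  shows "measure P {\<omega>\<in>space P. Q \<omega>} = (\<Sum>(j, A)\<in>J. arrangement_prob n (card A))"
proof -
  let ?E = "\<lambda>p \<omega>. strictly_above {1..n} (\<lambda>i. T i \<omega>) (fst p) (snd p)"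
  have finJ: "finite J"
    using assms(6) by (rule finite_subset) (simp add: finite_SigmaI finite_critical_sets)
  have J: "fst p \<in> {1..n}" "snd p \<subseteq> {1..n} - {fst p}" "\<phi> (insert (fst p) (snd p))" "\<not> \<phi> (snd p)"
    if "p \<in> J" for p
  proof -
    have "fst p \<in> {1..n} \<and> snd p \<in> critical_sets n \<phi> (fst p)"
      using assms(6) that by auto
    then show "fst p \<in> {1..n}" "snd p \<subseteq> {1..n} - {fst p}" "\<phi> (insert (fst p) (snd p))" "\<not> \<phi> (snd p)"
      by (simp_all add: critical_sets_def)
  qed
  have noties: "AE \<omega> in P. inj_on (\<lambda>i. T i \<omega>) {1..n}"
    by (rule AE_inj_on_if_no_ties) (fact assms finite_atLeastAtMost)+
  have "measure P {\<omega>\<in>space P. Q \<omega>} = (\<Sum>p\<in>J. measure P {\<omega>\<in>space P. ?E p \<omega>})"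
  proof (rule measure_eq_sum_AE[OF assms(1) finJ assms(7)])
    show "{\<omega>\<in>space P. ?E p \<omega>} \<in> sets P" if "p \<in> J" for p
      using J(1)[OF that] assms(3) by (intro sets_strictly_above) auto
    show "AE \<omega> in P. Q \<omega> \<longleftrightarrow> (\<exists>p\<in>J. ?E p \<omega>)"
      using noties by eventually_elim (simp add: assms(8) case_prod_unfold)
    \<comment> \<open>Two critical pairs realised at the same outcome both name the lifetime of the system,
      so their components have equal lifetimes and hence coincide.\<close>
    show "p = q" if "p \<in> J" "q \<in> J" "?E p \<omega>" "?E q \<omega>" for p q \<omega>
    proof -
      have "system_lifetime n \<phi> T \<omega> = T (fst p) \<omega>" "system_lifetime n \<phi> T \<omega> = T (fst q) \<omega>"
        using that J by (simp_all add: system_lifetime_eq_component_iff[OF assms(2)])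
      then have "T (fst p) \<omega> = T (fst q) \<omega>" by simp
      moreover from this have A: "snd p = snd q"
        using that(3,4) by (auto simp: strictly_above_def)
      ultimately have "insert (fst p) (snd p) = insert (fst q) (snd p)"
        using that(3,4) by (auto simp: strictly_above_def)
      then have "fst p = fst q" using J(2)[OF that(1)] J(2)[OF that(2)] A by blast
      then show ?thesis using A by (simp add: prod_eq_iff)
    qed
  qed
  also have "\<dots> = (\<Sum>p\<in>J. arrangement_prob n (card (snd p)))"
  proof (rule sum.cong[OF refl])
    fix p assume p: "p \<in> J"
    have "measure P {\<omega>\<in>space P. ?E p \<omega>} = arrangement_prob (card {1..n}) (card (snd p))"
      by (rule measure_strictly_above) (fact assms finite_atLeastAtMost J[OF p])+
    then show "measure P {\<omega>\<in>space P. ?E p \<omega>} = arrangement_prob n (card (snd p))"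
      by simp
  qed
  finally show ?thesis by (simp add: case_prod_unfold)
qed

lemma barlow_proschan_eq_sum_critical:
  fixes T :: "nat \<Rightarrow> 'a \<Rightarrow> real"
  assumes "prob_space P" "semicoherent n \<phi>" "\<And>i. i \<in> {1..n} \<Longrightarrow> T i \<in> borel_measurable P"
    and "exchangeable P {1..n} T" "no_ties P {1..n} T" and "j \<in> {1..n}"
  shows "barlow_proschan n \<phi> P T j = (\<Sum>A\<in>critical_sets n \<phi> j. arrangement_prob n (card A))"
proof -
  have "barlow_proschan n \<phi> P T j =
      (\<Sum>(j, A)\<in>Sigma {j} (critical_sets n \<phi>). arrangement_prob n (card A))"
    unfolding barlow_proschan_def
  proof (rule measure_eq_sum_critical)
    show "{\<omega>\<in>space P. system_lifetime n \<phi> T \<omega> = T j \<omega>} \<in> sets P"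
      unfolding system_lifetime_eq_iff[OF assms(2)]
      by (rule sets_comparison) (fact assms finite_atLeastAtMost)+
    fix \<omega> assume inj: "inj_on (\<lambda>i. T i \<omega>) {1..n}"
    let ?A = "{i\<in>{1..n}. T j \<omega> < T i \<omega>}"
    have above: "strictly_above {1..n} (\<lambda>i. T i \<omega>) j ?A"
      by (rule strictly_above_if_inj_on[OF inj assms(6)])
    have "system_lifetime n \<phi> T \<omega> = T j \<omega> \<longleftrightarrow> ?A \<in> critical_sets n \<phi> j"
      unfolding system_lifetime_eq_component_iff[of n \<phi> T \<omega>, OF assms(2) above]
      by (auto simp: critical_sets_def)
    also have "\<dots> \<longleftrightarrow> (\<exists>(j, A)\<in>Sigma {j} (critical_sets n \<phi>).
        strictly_above {1..n} (\<lambda>i. T i \<omega>) j A)"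
      using above by (auto simp: strictly_above_def)
    finally show "system_lifetime n \<phi> T \<omega> = T j \<omega> \<longleftrightarrow> \<dots>" .
  next
    show "Sigma {j} (critical_sets n \<phi>) \<subseteq> Sigma {1..n} (critical_sets n \<phi>)"
      using assms(6) by (intro Sigma_mono) simp_all
  qed (fact assms)+
  also have "\<dots> = (\<Sum>A\<in>critical_sets n \<phi> j. arrangement_prob n (card A))"
    by (subst sum.Sigma[symmetric]) (auto simp: finite_critical_sets)
  finally show ?thesis .
qed

text \<open>
  When \<open>j\<close> kills the system and \<open>A\<close> is the set of survivors, the rank of \<open>j\<close> inside \<open>M\<close> is the size
  of \<open>M\<close> less the number of survivors in \<open>M\<close>.
\<close>
lemma M_signature_eq_sum_critical:
  fixes T :: "nat \<Rightarrow> 'a \<Rightarrow> real"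
  assumes "prob_space P" "semicoherent n \<phi>" "\<And>i. i \<in> {1..n} \<Longrightarrow> T i \<in> borel_measurable P"
    and "exchangeable P {1..n} T" "no_ties P {1..n} T"
    and "M \<subseteq> {1..n}" "k \<in> {1..card M}"
  shows "M_signature n \<phi> P T M k =
    (\<Sum>(j, A)\<in>{p\<in>Sigma M (critical_sets n \<phi>). card M - card (snd p \<inter> M) = k}.
      arrangement_prob n (card A))"
  unfolding M_signature_def
proof (rule measure_eq_sum_critical)
  let ?S = "system_lifetime n \<phi> T" and ?O = "order_statistic k M T"
  have finM: "finite M" using assms(6) finite_subset by blast
  have sub: "{i\<in>M. Q i} = {i\<in>{1..n}. Q i} \<inter> M" for Q using assms(6) by auto
  \<comment> \<open>Naming the component whose lifetime is the order statistic turns the event into a condition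
    on comparisons with that component, which is measurable even when there are ties.\<close>
  have ex: "?S \<omega> = ?O \<omega> \<longleftrightarrow> (\<exists>j\<in>M. ?S \<omega> = T j \<omega> \<and> ?O \<omega> = T j \<omega>)" for \<omega>
    using order_statistic_in[OF finM assms(7), of T \<omega>] by auto
  have "{\<omega>\<in>space P. ?S \<omega> = T j \<omega> \<and> ?O \<omega> = T j \<omega>} \<in> sets P" if "j \<in> M" for j
    unfolding system_lifetime_eq_iff[OF assms(2)] order_statistic_eq_iff[OF finM assms(7)] sub
    by (rule sets_comparison) (fact assms finite_atLeastAtMost subsetD[OF assms(6) that])+
  then show "{\<omega>\<in>space P. ?S \<omega> = ?O \<omega>} \<in> sets P"
    unfolding ex by (intro sets.sets_Collect_finite_Ex finM)
  fix \<omega> assume inj: "inj_on (\<lambda>i. T i \<omega>) {1..n}"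
  let ?A = "\<lambda>j. {i\<in>{1..n}. T j \<omega> < T i \<omega>}"
  have "?S \<omega> = T j \<omega> \<and> ?O \<omega> = T j \<omega> \<longleftrightarrow>
      ?A j \<in> critical_sets n \<phi> j \<and> card M - card (?A j \<inter> M) = k" if j: "j \<in> M" for j
  proof -
    have above: "strictly_above {1..n} (\<lambda>i. T i \<omega>) j (?A j)"
      using assms(6) j by (intro strictly_above_if_inj_on[OF inj]) auto
    have "{i\<in>{1..n}. T j \<omega> \<le> T i \<omega>} \<inter> M = insert j (?A j \<inter> M)"
      using above j by (auto simp: strictly_above_def)
    then have "card ({i\<in>{1..n}. T j \<omega> \<le> T i \<omega>} \<inter> M) = Suc (card (?A j \<inter> M))" by simp
    then have "?O \<omega> = T j \<omega> \<longleftrightarrow> card (?A j \<inter> M) = card M - k"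
      unfolding order_statistic_eq_iff[OF finM assms(7)] sub by auto
    also have "\<dots> \<longleftrightarrow> card M - card (?A j \<inter> M) = k"
      using assms(7) card_mono[OF finM, of "?A j \<inter> M"] by auto
    moreover have "?S \<omega> = T j \<omega> \<longleftrightarrow> ?A j \<in> critical_sets n \<phi> j"
      unfolding system_lifetime_eq_component_iff[of n \<phi> T \<omega>, OF assms(2) above]
      by (auto simp: critical_sets_def)
    ultimately show ?thesis by simp
  qed
  then have "?S \<omega> = ?O \<omega> \<longleftrightarrow>
      (\<exists>j\<in>M. ?A j \<in> critical_sets n \<phi> j \<and> card M - card (?A j \<inter> M) = k)"
    unfolding ex by simp
  also have "\<dots> \<longleftrightarrow> (\<exists>(j, A)\<in>{p\<in>Sigma M (critical_sets n \<phi>). card M - card (snd p \<inter> M) = k}.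
      strictly_above {1..n} (\<lambda>i. T i \<omega>) j A)" (is "?lhs \<longleftrightarrow> ?rhs")
  proof
    assume ?lhs
    then obtain j where j: "j \<in> M" "?A j \<in> critical_sets n \<phi> j" "card M - card (?A j \<inter> M) = k" by blast
    moreover have "strictly_above {1..n} (\<lambda>i. T i \<omega>) j (?A j)"
      using assms(6) j(1) by (intro strictly_above_if_inj_on[OF inj]) auto
    ultimately show ?rhs by (intro bexI[of _ "(j, ?A j)"]) auto
  next
    assume ?rhs
    then obtain j A where "j \<in> M" "A \<in> critical_sets n \<phi> j" "card M - card (A \<inter> M) = k"
      "strictly_above {1..n} (\<lambda>i. T i \<omega>) j A" by auto
    moreover from this have "?A j = A" by (simp add: strictly_above_def)
    ultimately show ?lhs by (intro bexI[of _ j]) simp_all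
  qed
  finally show "?S \<omega> = ?O \<omega> \<longleftrightarrow> \<dots>" .
next
  show "{p\<in>Sigma M (critical_sets n \<phi>). card M - card (snd p \<inter> M) = k}
      \<subseteq> Sigma {1..n} (critical_sets n \<phi>)"
    using Sigma_mono[OF assms(6) order_refl] by blast
qed (fact assms)+

section \<open>The derivative of the reliability function\<close>

lemma prod_if_mem_const:
  "finite D \<Longrightarrow> (\<Prod>i\<in>D. if i \<in> B then p else q) = p ^ card (D \<inter> B) * q ^ card (D - B)"
  for p q :: "'r::comm_monoid_mult"
  by (simp add: prod.If_cases Int_def[symmetric] Diff_eq)

lemma sum_Pow_split:
  assumes "finite C" "j \<in> C"
  shows "(\<Sum>A\<in>Pow C. F A) = (\<Sum>B\<in>Pow (C - {j}). F (insert j B) + F B)"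
proof -
  have "Pow C = insert j ` Pow (C - {j}) \<union> Pow (C - {j})"
    using Pow_insert[of j "C - {j}"] assms(2) by (simp add: insert_absorb Un_commute)
  moreover have "inj_on (insert j) (Pow (C - {j}))" by (auto simp: inj_on_def)
  moreover have "insert j ` Pow (C - {j}) \<inter> Pow (C - {j}) = {}" by auto
  ultimately show ?thesis
    using assms(1) by (simp add: sum.union_disjoint sum.reindex sum.distrib)
qed

text \<open>
  Since the reliability function is multilinear, its derivative is obtained by the chain rule from
  the partial derivatives, and the one in direction \<open>j\<close> is the probability that the state of \<open>j\<close>
  is decisive.
\<close>
lemma pderiv_reliability:
  fixes x :: "nat \<Rightarrow> 'r::idom poly"
  assumes "semicoherent n \<phi>"
  shows "pderiv (reliability n \<phi> x) =
    (\<Sum>j=1..n. \<Sum>A\<in>critical_sets n \<phi> j.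
      (\<Prod>i\<in>{1..n} - {j}. if i \<in> A then x i else 1 - x i) * pderiv (x j))"
proof -
  let ?u = "\<lambda>A i. if i \<in> A then x i else 1 - x i"
  let ?F = "\<lambda>j A. of_bool (\<phi> A) * (\<Prod>i\<in>{1..n} - {j}. ?u A i) * pderiv (?u A j)"
  have term_eq: "of_bool (\<phi> A) * (\<Prod>i\<in>A. x i) * (\<Prod>i\<in>{1..n} - A. 1 - x i) =
      of_bool (\<phi> A) * (\<Prod>i=1..n. ?u A i)" if "A \<in> Pow {1..n}" for A
  proof -
    have "{1..n} \<inter> {i. i \<in> A} = A" "{1..n} \<inter> - {i. i \<in> A} = {1..n} - A" using that by auto
    then show ?thesis by (simp add: prod.If_cases mult.assoc)
  qed
  have "pderiv (reliability n \<phi> x) = (\<Sum>A\<in>Pow {1..n}. pderiv (of_bool (\<phi> A) * (\<Prod>i=1..n. ?u A i)))"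
    unfolding reliability_def higher_pderiv_sum[of 1, simplified]
    by (rule sum.cong[OF refl]) (simp only: term_eq)
  also have "\<dots> = (\<Sum>A\<in>Pow {1..n}. \<Sum>j=1..n. ?F j A)"
    by (rule sum.cong[OF refl]) (simp add: of_bool_def pderiv_prod)
  also have "\<dots> = (\<Sum>j=1..n. \<Sum>A\<in>Pow {1..n}. ?F j A)"
    by (rule sum.swap)
  also have "\<dots> = (\<Sum>j=1..n. \<Sum>A\<in>critical_sets n \<phi> j.
      (\<Prod>i\<in>{1..n} - {j}. ?u A i) * pderiv (x j))"
  \<comment> \<open>Pairing \<open>A\<close> with \<open>insert j A\<close> leaves the difference of the two values of \<open>\<phi>\<close>, which by
    monotonicity is 1 on the critical sets and 0 elsewhere.\<close>
  proof (rule sum.cong[OF refl])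
    fix j assume j: "j \<in> {1..n}"
    have "(\<Sum>A\<in>Pow {1..n}. ?F j A) = (\<Sum>A\<in>Pow ({1..n} - {j}). ?F j (insert j A) + ?F j A)"
      using j by (intro sum_Pow_split) auto
    also have "\<dots> = (\<Sum>A\<in>Pow ({1..n} - {j}). if A \<in> critical_sets n \<phi> j then
        (\<Prod>i\<in>{1..n} - {j}. ?u A i) * pderiv (x j) else 0)"
    proof (rule sum.cong[OF refl])
      fix A assume A: "A \<in> Pow ({1..n} - {j})"
      have "(\<Prod>i\<in>{1..n} - {j}. ?u (insert j A) i) = (\<Prod>i\<in>{1..n} - {j}. ?u A i)"
        by (rule prod.cong) auto
      moreover have "j \<notin> A" using A by auto
      ultimately have "?F j (insert j A) + ?F j A = (of_bool (\<phi> (insert j A)) - of_bool (\<phi> A)) *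
          ((\<Prod>i\<in>{1..n} - {j}. ?u A i) * pderiv (x j))"
        by (simp add: pderiv_diff pderiv_1 algebra_simps)
      moreover have "\<phi> A \<Longrightarrow> \<phi> (insert j A)"
        using semicoherent_mono[OF assms, of A "insert j A"] A j by blast
      ultimately show "?F j (insert j A) + ?F j A =
          (if A \<in> critical_sets n \<phi> j then (\<Prod>i\<in>{1..n} - {j}. ?u A i) * pderiv (x j) else 0)"
        using A by (auto simp: critical_sets_def)
    qed
    also have "\<dots> = (\<Sum>A\<in>critical_sets n \<phi> j. (\<Prod>i\<in>{1..n} - {j}. ?u A i) * pderiv (x j))"
    proof -
      have "Pow ({1..n} - {j}) \<inter> critical_sets n \<phi> j = critical_sets n \<phi> j"
        by (auto simp: critical_sets_def)
      then show ?thesis by (simp add: sum.inter_restrict[symmetric] del: Pow_iff)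
    qed
    finally show "(\<Sum>A\<in>Pow {1..n}. ?F j A) = \<dots>" .
  qed
  finally show ?thesis .
qed

lemma pderiv_bivariate_reliability:
  assumes "semicoherent n \<phi>" "M \<subseteq> {1..n}"
  shows "pderiv (bivariate_reliability n \<phi> M) =
    (\<Sum>(j, A)\<in>Sigma M (critical_sets n \<phi>).
      smult ([:0, 1:] ^ card (A - M) * [:1, -1:] ^ card ({1..n} - M - A))
        ([:0, 1:] ^ card (A \<inter> M) * [:1, -1:] ^ card (M - {j} - A)))"
proof -
  let ?x = "\<lambda>i. if i \<in> M then [:0, 1:] else [:[:0, 1 :: real:]:]"
  let ?f = "\<lambda>j A. smult ([:0, 1:] ^ card (A - M) * [:1, -1:] ^ card ({1..n} - M - A))
        ([:0, 1:] ^ card (A \<inter> M) * [:1, -1:] ^ card (M - {j} - A)) :: real poly poly"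
  have finM: "finite M" using assms(2) finite_subset by blast
  have prod_eq: "(\<Prod>i\<in>{1..n} - {j}. if i \<in> A then ?x i else 1 - ?x i) = ?f j A"
    if "j \<in> M" "A \<in> critical_sets n \<phi> j" for j A
  proof -
    have A: "A \<subseteq> {1..n} - {j}" using that by (simp add: critical_sets_def)
    have split: "{1..n} - {j} = (M - {j}) \<union> ({1..n} - M)" using that assms(2) by auto
    have "(\<Prod>i\<in>{1..n} - {j}. if i \<in> A then ?x i else 1 - ?x i) =
        (\<Prod>i\<in>M - {j}. if i \<in> A then ?x i else 1 - ?x i) *
        (\<Prod>i\<in>{1..n} - M. if i \<in> A then ?x i else 1 - ?x i)"
      unfolding split using finM by (intro prod.union_disjoint) auto
    also have "(\<Prod>i\<in>M - {j}. if i \<in> A then ?x i else 1 - ?x i) =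
        (\<Prod>i\<in>M - {j}. if i \<in> A then [:0, 1:] else [:1, -1:])"
      by (rule prod.cong) (auto simp: one_pCons)
    also have "\<dots> = [:0, 1:] ^ card (A \<inter> M) * [:1, -1:] ^ card (M - {j} - A)"
    proof -
      have "(M - {j}) \<inter> A = A \<inter> M" using A by auto
      then show ?thesis using finM by (simp only: prod_if_mem_const finite_Diff)
    qed
    also have "(\<Prod>i\<in>{1..n} - M. if i \<in> A then ?x i else 1 - ?x i) =
        (\<Prod>i\<in>{1..n} - M. if i \<in> A then [:[:0, 1:]:] else [:[:1, -1:]:])"
      by (rule prod.cong) (auto simp: one_pCons)
    also have "\<dots> = [:[:0, 1:]:] ^ card (A - M) * [:[:1, -1:]:] ^ card ({1..n} - M - A)"
    proof -
      have "({1..n} - M) \<inter> A = A - M" using A by auto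
      then show ?thesis by (simp only: prod_if_mem_const finite_Diff finite_atLeastAtMost)
    qed
    also have "\<dots> = [:[:0, 1:] ^ card (A - M) * [:1, -1:] ^ card ({1..n} - M - A):]"
      by (simp add: poly_const_pow)
    finally show ?thesis by (simp add: mult.commute)
  qed
  have "pderiv (bivariate_reliability n \<phi> M) = (\<Sum>j=1..n. \<Sum>A\<in>critical_sets n \<phi> j.
      (\<Prod>i\<in>{1..n} - {j}. if i \<in> A then ?x i else 1 - ?x i) * pderiv (?x j))"
    unfolding bivariate_reliability_def by (rule pderiv_reliability[OF assms(1)])
  also have "\<dots> = (\<Sum>j\<in>M. \<Sum>A\<in>critical_sets n \<phi> j.
      (\<Prod>i\<in>{1..n} - {j}. if i \<in> A then ?x i else 1 - ?x i) * pderiv (?x j))"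
    using assms(2) by (intro sum.mono_neutral_right) (auto simp: pderiv_pCons)
  also have "\<dots> = (\<Sum>j\<in>M. \<Sum>A\<in>critical_sets n \<phi> j. ?f j A)"
  proof (intro sum.cong refl)
    fix j A assume j: "j \<in> M" "A \<in> critical_sets n \<phi> j"
    have "pderiv (?x j) = 1" using j(1) by (simp add: pderiv_pCons one_pCons)
    then show "(\<Prod>i\<in>{1..n} - {j}. if i \<in> A then ?x i else 1 - ?x i) * pderiv (?x j) = ?f j A"
      by (simp only: prod_eq[OF j] mult_1_right)
  qed
  also have "\<dots> = (\<Sum>(j, A)\<in>Sigma M (critical_sets n \<phi>). ?f j A)"
    using finM finite_critical_sets by (intro sum.Sigma) auto
  finally show ?thesis .
qed

section \<open>Reflections\<close>

text \<open>
  This reduces the reflection at a degree bound to the reflection at the degree, which is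
  multiplicative.
\<close>
lemma reflected_eq_reflect_poly:
  fixes f :: "'r::idom poly"
  assumes "degree f \<le> p"
  shows "reflected p f = monom 1 (p - degree f) * reflect_poly f"
proof (rule poly_eqI)
  fix k
  have *: "reflected p f = (\<Sum>i\<le>p. monom (coeff f (p - i)) i)"
    unfolding reflected_def
    by (rule sum.reindex_bij_witness[of _ "\<lambda>i. p - i" "\<lambda>i. p - i"]) auto
  have "coeff (reflected p f) k = (if k \<le> p then coeff f (p - k) else 0)"
    unfolding * by (simp add: coeff_sum)
  also have "\<dots> = coeff (monom 1 (p - degree f) * reflect_poly f) k"
    using assms by (auto simp: coeff_monom_mult coeff_reflect_poly coeff_eq_0)
  finally show "coeff (reflected p f) k = \<dots>" .
qed

lemma reflected_linear:
  shows "reflected p (\<Sum>i\<in>I. f i) = (\<Sum>i\<in>I. reflected p (f i))"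
    and "reflected p (smult c h) = smult c (reflected p h)"
proof -
  show "reflected p (\<Sum>i\<in>I. f i) = (\<Sum>i\<in>I. reflected p (f i))"
    unfolding reflected_def by (subst sum.swap) (simp add: coeff_sum monom_sum)
  have "smult c (\<Sum>i\<in>K. k i) = (\<Sum>i\<in>K. smult c (k i))" for K and k :: "nat \<Rightarrow> _"
    by (induction K rule: infinite_finite_induct) (simp_all add: smult_add_right)
  then show "reflected p (smult c h) = smult c (reflected p h)"
    by (simp add: reflected_def smult_monom)
qed

lemma reflected_bernstein:
  "reflected (a + b) ([:0, 1:] ^ a * [:1, -1:] ^ b :: 'r::idom poly) = [:-1, 1:] ^ b"
proof -
  have "degree ([:0, 1:] ^ a * [:1, -1:] ^ b :: 'r poly) = a + b"
    by (subst degree_mult_eq) (auto simp: degree_power_eq)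
  moreover have "reflect_poly [:0, 1:] = (1 :: 'r poly)"
    by (simp add: reflect_poly_def one_pCons)
  ultimately show ?thesis
    by (subst reflected_eq_reflect_poly)
       (auto simp: reflect_poly_mult reflect_poly_power reflect_poly_pCons)
qed

lemma reflected_linear_power:
  "reflected (a + b) ([:-1, 1:] ^ b :: 'r::idom poly) = [:0, 1:] ^ a * [:1, -1:] ^ b"
proof -
  have "reflect_poly [:-1, 1:] = [:1, -1 :: 'r:]"
    by (simp add: reflect_poly_pCons)
  then show ?thesis
    by (subst reflected_eq_reflect_poly)
       (simp_all add: reflect_poly_power degree_power_eq monom_altdef)
qed

lemma affine_subst_linear_power:
  "affine_subst x ([:-1, 1:] ^ b) = smult [:x ^ b:] ([:-1, 1:] ^ b)"
proof -
  have "affine_subst x [:-1, 1:] = smult [:x:] [:-1, 1:]"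
    by (simp add: affine_subst_def pcompose_pCons one_pCons)
  moreover have "affine_subst x ([:-1, 1:] ^ b) = affine_subst x [:-1, 1:] ^ b"
    by (induction b) (simp_all only: affine_subst_def power_0 power_Suc pcompose_1 pcompose_mult)
  ultimately show ?thesis
    by (simp only: smult_power poly_const_pow)
qed

lemma affine_subst_linear:
  shows "affine_subst x (\<Sum>i\<in>I. f i) = (\<Sum>i\<in>I. affine_subst x (f i))"
    and "affine_subst x (smult q h) = smult q (affine_subst x h)"
  by (simp_all add: affine_subst_def pcompose_sum pcompose_smult)

text \<open>
  The purpose of the two reflections: the first one turns \<open>t ^ a * (1 - t) ^ b\<close> into
  \<open>(t - 1) ^ b\<close>, so that the substitution multiplies it by \<open>x ^ b\<close>; the second one restores the
  polynomial. Thus \<open>x\<close> comes to count the failed components among the other members of \<open>M\<close>.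
\<close>
lemma reflect_subst_reflect_bernstein:
   "reflected (a + b) (affine_subst x (reflected (a + b) (smult q ([:0, 1:] ^ a * [:1, -1:] ^ b))))
     = smult (q * [:x ^ b:]) ([:0, 1:] ^ a * [:1, -1:] ^ b)"
  by (simp only: reflected_linear(2) reflected_bernstein affine_subst_linear(2)
      affine_subst_linear_power reflected_linear_power smult_smult)

section \<open>The integrands on the diagonal\<close>

lemma critical_set_cards:
  assumes "M \<subseteq> {1..n}" "j \<in> M" "A \<in> critical_sets n \<phi> j"
  shows "card (A \<inter> M) + card (M - {j} - A) = card M - 1"
    and "card (A \<inter> M) + card (A - M) = card A"
    and "card (M - {j} - A) + card ({1..n} - M - A) = n - 1 - card A"
    and "card A < n" and "Suc (card (M - {j} - A)) = card M - card (A \<inter> M)"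
proof -
  have A: "A \<subseteq> {1..n} - {j}" using assms by (simp add: critical_sets_def)
  have fin: "finite A" "finite M" using assms A by (meson finite_Diff finite_atLeastAtMost finite_subset)+
  have "card M = Suc (card (M - {j}))" using card_Suc_Diff1[OF fin(2) assms(2)] by simp
  moreover have "card (M - {j}) = card (A \<inter> M) + card (M - {j} - A)"
    using fin A by (subst card_Un_disjoint[symmetric]) (auto intro!: arg_cong[of _ _ card])
  ultimately show "card (A \<inter> M) + card (M - {j} - A) = card M - 1"
    "Suc (card (M - {j} - A)) = card M - card (A \<inter> M)" by auto
  show "card (A \<inter> M) + card (A - M) = card A"
    using fin by (subst card_Un_disjoint[symmetric]) (auto intro!: arg_cong[of _ _ card])
  have j: "j \<in> {1..n}" using assms by auto
  have "card (M - {j} - A) + card ({1..n} - M - A) = card ({1..n} - {j} - A)"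
    using fin assms(1,2) by (subst card_Un_disjoint[symmetric]) (auto intro!: arg_cong[of _ _ card])
  also have "\<dots> = n - 1 - card A" using A fin j by (simp add: card_Diff_subset)
  finally show "card (M - {j} - A) + card ({1..n} - M - A) = n - 1 - card A" .
  have "card A \<le> card ({1..n} - {j})" using A by (intro card_mono) auto
  then show "card A < n" using j by auto
qed

lemma poly2_sum: "poly2 (\<Sum>i\<in>I. f i) x z = (\<Sum>i\<in>I. poly2 (f i) x z)"
  by (simp add: poly2_def poly_sum)

lemma poly2_bernstein:
  "poly2 (smult q ([:0, 1:] ^ a * [:1, -1:] ^ b)) x z = poly q z * (x ^ a * (1 - x) ^ b)"
  by (simp add: poly2_def poly_power)

lemma poly_linear:
  fixes x :: real
  shows "poly [:c:] x = c" "poly [:0, 1:] x = x" "poly [:1, -1:] x = 1 - x"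
  by simp_all

lemma poly2_pderiv_diagonal:
  assumes "semicoherent n \<phi>" "M \<subseteq> {1..n}"
  shows "poly2 (pderiv (bivariate_reliability n \<phi> M)) t t =
    (\<Sum>(j, A)\<in>Sigma M (critical_sets n \<phi>). t ^ card A * (1 - t) ^ (n - 1 - card A))"
  unfolding pderiv_bivariate_reliability[OF assms] poly2_sum
proof (rule sum.cong[OF refl], safe)
  fix j A assume "j \<in> M" "A \<in> critical_sets n \<phi> j"
  note cards = critical_set_cards[OF assms(2) this]
  show "poly2 (smult ([:0, 1:] ^ card (A - M) * [:1, -1:] ^ card ({1..n} - M - A))
        ([:0, 1:] ^ card (A \<inter> M) * [:1, -1:] ^ card (M - {j} - A))) t t =
      t ^ card A * (1 - t) ^ (n - 1 - card A)"
    unfolding poly2_bernstein cards(3)[symmetric]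
    by (simp only: cards(2)[symmetric] poly_mult poly_power power_add poly_linear mult_ac)
qed

text \<open>
  Of the exponent of \<open>x\<close>, all but one comes from the other members of \<open>M\<close> outside \<open>A\<close>; the factor
  in front accounts for \<open>j\<close> itself.
\<close>
lemma poly2_reflected_diagonal:
  assumes "semicoherent n \<phi>" "M \<subseteq> {1..n}"
  shows "x * poly2 (reflected (card M - 1) (affine_subst x (reflected (card M - 1)
      (pderiv (bivariate_reliability n \<phi> M))))) t t =
    (\<Sum>(j, A)\<in>Sigma M (critical_sets n \<phi>).
      x ^ (card M - card (A \<inter> M)) * (t ^ card A * (1 - t) ^ (n - 1 - card A)))"
  unfolding pderiv_bivariate_reliability[OF assms] reflected_linear(1) affine_subst_linear(1) poly2_sum
    sum_distrib_left
proof (rule sum.cong[OF refl], safe)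
  fix j A assume "j \<in> M" "A \<in> critical_sets n \<phi> j"
  note cards = critical_set_cards[OF assms(2) this]
  show "x * poly2 (reflected (card M - 1) (affine_subst x (reflected (card M - 1)
      (smult ([:0, 1:] ^ card (A - M) * [:1, -1:] ^ card ({1..n} - M - A))
        ([:0, 1:] ^ card (A \<inter> M) * [:1, -1:] ^ card (M - {j} - A)))))) t t =
      x ^ (card M - card (A \<inter> M)) * (t ^ card A * (1 - t) ^ (n - 1 - card A))"
    unfolding cards(1)[symmetric] reflect_subst_reflect_bernstein poly2_bernstein
      cards(5)[symmetric] cards(3)[symmetric]
    by (simp only: cards(2)[symmetric] poly_mult poly_power power_add power_Suc poly_linear mult_ac)
qed

section \<open>The generating function of the signature\<close>

lemma signature_generating_function:
  fixes T :: "nat \<Rightarrow> 'a \<Rightarrow> real"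
  assumes "prob_space P" "semicoherent n \<phi>" "\<And>i. i \<in> {1..n} \<Longrightarrow> T i \<in> borel_measurable P"
    and "exchangeable P {1..n} T" "no_ties P {1..n} T" and "M \<subseteq> {1..n}"
  shows "(\<Sum>k=1..card M. M_signature n \<phi> P T M k * x ^ k) =
    (\<Sum>(j, A)\<in>Sigma M (critical_sets n \<phi>).
      x ^ (card M - card (A \<inter> M)) * arrangement_prob n (card A))"
proof -
  let ?K = "Sigma M (critical_sets n \<phi>)"
  let ?w = "\<lambda>p. arrangement_prob n (card (snd p))"
  let ?e = "\<lambda>p. card M - card (snd p \<inter> M)"
  have "finite M" using assms(6) finite_subset by blast
  then have finK: "finite ?K" by (simp add: finite_SigmaI finite_critical_sets)
  have e: "?e p \<in> {1..card M}" if "p \<in> ?K" for p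
    using that critical_set_cards(5)[OF assms(6), of "fst p" "snd p" \<phi>] by auto
  have "(\<Sum>k=1..card M. M_signature n \<phi> P T M k * x ^ k) =
      (\<Sum>k=1..card M. \<Sum>p\<in>{p\<in>?K. ?e p = k}. x ^ ?e p * ?w p)"
  proof (rule sum.cong[OF refl])
    fix k assume "k \<in> {1..card M}"
    from M_signature_eq_sum_critical[OF assms this]
    have sum_eq: "M_signature n \<phi> P T M k = (\<Sum>p\<in>{p\<in>?K. ?e p = k}. ?w p)"
      by (simp only: case_prod_unfold)
    show "M_signature n \<phi> P T M k * x ^ k = (\<Sum>p\<in>{p\<in>?K. ?e p = k}. x ^ ?e p * ?w p)"
      unfolding sum_eq sum_distrib_right by (intro sum.cong) auto
  qed
  \<comment> \<open>Each critical pair contributes to exactly one rank \<open>k\<close>.\<close>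
  also have "\<dots> = (\<Sum>p\<in>?K. x ^ ?e p * ?w p)"
    using finK e by (intro sum.group) auto
  finally show ?thesis by (simp add: case_prod_unfold)
qed

lemma sum_barlow_proschan:
  fixes T :: "nat \<Rightarrow> 'a \<Rightarrow> real"
  assumes "prob_space P" "semicoherent n \<phi>" "\<And>i. i \<in> {1..n} \<Longrightarrow> T i \<in> borel_measurable P"
    and "exchangeable P {1..n} T" "no_ties P {1..n} T" and "M \<subseteq> {1..n}"
  shows "(\<Sum>j\<in>M. barlow_proschan n \<phi> P T j) =
    (\<Sum>(j, A)\<in>Sigma M (critical_sets n \<phi>). arrangement_prob n (card A))"
proof -
  have "finite M" using assms(6) finite_subset by blast
  have "(\<Sum>j\<in>M. barlow_proschan n \<phi> P T j) =
      (\<Sum>j\<in>M. \<Sum>A\<in>critical_sets n \<phi> j. arrangement_prob n (card A))"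
    using barlow_proschan_eq_sum_critical[OF assms(1-5)] assms(6) by (intro sum.cong refl) blast
  also have "\<dots> = (\<Sum>(j, A)\<in>Sigma M (critical_sets n \<phi>). arrangement_prob n (card A))"
    using \<open>finite M\<close> by (intro sum.Sigma) (simp_all add: finite_critical_sets)
  finally show ?thesis .
qed

lemma integral_critical_pairs:
  assumes "M \<subseteq> {1..n}"
  shows "integral {0..1} (\<lambda>t::real. \<Sum>(j, A)\<in>Sigma M (critical_sets n \<phi>).
      c j A * (t ^ card A * (1 - t) ^ (n - 1 - card A))) =
    (\<Sum>(j, A)\<in>Sigma M (critical_sets n \<phi>). c j A * arrangement_prob n (card A))"
  unfolding case_prod_unfold
proof (rule integral_sum_bernstein)
  show "finite (Sigma M (critical_sets n \<phi>))"
    using assms finite_subset by (blast intro: finite_SigmaI finite_critical_sets)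
  show "card (snd p) < n" if "p \<in> Sigma M (critical_sets n \<phi>)" for p
    using that critical_set_cards(4)[OF assms, of "fst p" "snd p" \<phi>] by auto
qed

theorem proposition2:
  fixes n m :: nat
    and \<phi> :: "nat set \<Rightarrow> bool"
    and P :: "'a measure"
    and T :: "nat \<Rightarrow> 'a \<Rightarrow> real"
    and M :: "nat set"
    and g :: "real poly poly"
  assumes "prob_space P"
    and "semicoherent n \<phi>"
    and "\<And>i. i \<in> {1..n} \<Longrightarrow> T i \<in> borel_measurable P"
    and "\<And>i \<omega>. i \<in> {1..n} \<Longrightarrow> \<omega> \<in> space P \<Longrightarrow> 0 \<le> T i \<omega>"
    and "exchangeable P {1..n} T"
    and "no_ties P {1..n} T"
    and "M \<subseteq> {1..n}" and "M \<noteq> {}"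
    and "m = card M"
    and "g = pderiv (bivariate_reliability n \<phi> M)"
  shows "(\<forall>x::real.
           (\<Sum>k=1..m. M_signature n \<phi> P T M k * x ^ k) =
           integral {0..1}
             (\<lambda>t. x * poly2 (reflected (m - 1) (affine_subst x (reflected (m - 1) g))) t t))
       \<and> (\<Sum>k=1..m. M_signature n \<phi> P T M k) = (\<Sum>j\<in>M. barlow_proschan n \<phi> P T j)
       \<and> (\<Sum>j\<in>M. barlow_proschan n \<phi> P T j) = integral {0..1} (\<lambda>t. poly2 g t t)"
proof -
  let ?K = "Sigma M (critical_sets n \<phi>)"
  note signature = signature_generating_function[OF assms(1,2,3,5,6,7), folded assms(9)]
  have "integral {0..1} (\<lambda>t. x * poly2 (reflected (m - 1) (affine_subst x (reflected (m - 1) g))) t t) =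
      (\<Sum>(j, A)\<in>?K. x ^ (m - card (A \<inter> M)) * arrangement_prob n (card A))" for x
    unfolding assms(9,10) poly2_reflected_diagonal[OF assms(2,7)]
    by (rule integral_critical_pairs[OF assms(7)])
  moreover have "integral {0..1} (\<lambda>t. poly2 g t t) = (\<Sum>(j, A)\<in>?K. arrangement_prob n (card A))"
    using integral_critical_pairs[OF assms(7), where c = "\<lambda>_ _. 1" and \<phi> = \<phi>]
    unfolding assms(10) poly2_pderiv_diagonal[OF assms(2,7)] by simp
  ultimately show ?thesis
    using signature signature[of 1] sum_barlow_proschan[OF assms(1,2,3,5,6,7)] by simp
qed

end
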